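(* Let $n\ge 1$ be an integer. Then: (i) the vertex covering number of $\Delta(SD_{8n})$ is $\beta(\Delta(SD_{8n}))=7$ if $n=1$; $\beta(\Delta(SD_{8n}))=6n-1$ if $n$ is even; and $\beta(\Delta(SD_{8n}))=7n-1$ otherwise (i.e. if $n\ge 3$ is odd); (ii) the edge covering number of $\Delta(SD_{8n})$ is $4n$.
   Context: For an integer $n\ge 1$, $SD_{8n}=\langle a,b : a^{4n}=b^2=e,\ ba=a^{2n-1}b\rangle$, a group of order $8n$. The commuting graph $\Delta(G)$ of a group $G$ is the simple graph with vertex set $G$ in which two distinct vertices $x,y$ are adjacent iff $xy=yx$. A vertex cover is a set of vertices containing at least one endpoint of every edge; the vertex covering number $\beta(\Gamma)$ is the minimum cardinality of a vertex cover. An edge cover is a set of edges such that every vertex is incident to some edge of the set; the edge covering number is the minimum cardinality of an edge cover. *)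

theory Defs
  imports "HOL-Algebra.Group"
begin

section \<open>Groups given by generators and relations\<close>

text \<open>
  A word is a list of signed generators: \<open>(x, True)\<close> stands for the generator \<open>x\<close> and
  \<open>(x, False)\<close> for its formal inverse. A relation \<open>u = v\<close> is the pair of words \<open>(u, v)\<close>.
\<close>

type_synonym 'g gword = "('g \<times> bool) list"

inductive pres_eq :: "('g gword \<times> 'g gword) set \<Rightarrow> 'g gword \<Rightarrow> 'g gword \<Rightarrow> bool"
  for R where
  refl: "pres_eq R u u"
| sym: "pres_eq R u v \<Longrightarrow> pres_eq R v u"
| trans: "pres_eq R u v \<Longrightarrow> pres_eq R v w \<Longrightarrow> pres_eq R u w"
| append: "pres_eq R u u' \<Longrightarrow> pres_eq R v v' \<Longrightarrow> pres_eq R (u @ v) (u' @ v')"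
| cancel: "pres_eq R [(x, s), (x, \<not> s)] []"
| relation: "(u, v) \<in> R \<Longrightarrow> pres_eq R u v"

definition pres_class :: "('g gword \<times> 'g gword) set \<Rightarrow> 'g gword \<Rightarrow> 'g gword set" where
  "pres_class R u = {v. pres_eq R u v}"

text \<open>
  The generators are all elements of the type \<open>'g\<close>. The product of two classes is the class of
  the concatenation of any representatives; see \<open>mult_pres_class\<close>.
\<close>

definition presented_group :: "('g gword \<times> 'g gword) set \<Rightarrow> 'g gword set monoid" where
  "presented_group R =
     \<lparr>carrier = range (pres_class R),
      mult = (\<lambda>A B. \<Union>u\<in>A. \<Union>v\<in>B. pres_class R (u @ v)),
      one = pres_class R []\<rparr>"

lemma pres_class_eq_iff: "pres_class R u = pres_class R v \<longleftrightarrow> pres_eq R u v"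
proof
  assume "pres_class R u = pres_class R v"
  then have "v \<in> pres_class R u" using pres_eq.refl by (simp add: pres_class_def)
  then show "pres_eq R u v" by (simp add: pres_class_def)
next
  assume "pres_eq R u v"
  then show "pres_class R u = pres_class R v"
    unfolding pres_class_def
    using pres_eq.trans[of R u v] pres_eq.trans[OF pres_eq.sym, of R u v] by blast
qed

lemma mult_pres_class:
  "pres_class R u \<otimes>\<^bsub>presented_group R\<^esub> pres_class R v = pres_class R (u @ v)"
proof -
  have eq: "pres_class R (u' @ v') = pres_class R (u @ v)"
    if "u' \<in> pres_class R u" "v' \<in> pres_class R v" for u' v'
  proof -
    have "pres_eq R u u'" "pres_eq R v v'"
      using that by (simp_all add: pres_class_def)
    then show ?thesis
      unfolding pres_class_eq_iff by (rule pres_eq.sym[OF pres_eq.append])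
  qed
  have "u \<in> pres_class R u" "v \<in> pres_class R v"
    by (simp_all add: pres_class_def pres_eq.refl)
  then have "(\<Union>u'\<in>pres_class R u. \<Union>v'\<in>pres_class R v. pres_class R (u' @ v')) =
      pres_class R (u @ v)"
    using eq by blast
  then show ?thesis
    by (simp add: presented_group_def)
qed

lemma pres_eq_inverse: "\<exists>v. pres_eq R (v @ u) []"
proof (induction u)
  case Nil
  show ?case by (rule exI[of _ "[]"]) (simp add: pres_eq.refl)
next
  case (Cons g u)
  obtain x s where g: "g = (x, s)" by fastforce
  from Cons obtain v where v: "pres_eq R (v @ u) []" by blast
  have "pres_eq R ([(x, \<not> s), (x, s)] @ u) ([] @ u)"
    using pres_eq.cancel[of R x "\<not> s"] by (intro pres_eq.append pres_eq.refl) simp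
  then have "pres_eq R (v @ ([(x, \<not> s), (x, s)] @ u)) (v @ ([] @ u))"
    by (rule pres_eq.append[OF pres_eq.refl])
  from pres_eq.trans[OF this] v have "pres_eq R ((v @ [(x, \<not> s)]) @ (g # u)) []"
    using g by simp
  then show ?case by blast
qed

lemma group_presented_group: "group (presented_group R)"
proof (rule groupI)
  show "\<one>\<^bsub>presented_group R\<^esub> \<in> carrier (presented_group R)"
    by (simp add: presented_group_def)
next
  have 1: "\<one>\<^bsub>presented_group R\<^esub> = pres_class R []"
    and C: "carrier (presented_group R) = range (pres_class R)"
    by (simp_all add: presented_group_def)
  fix x y z
  assume x: "x \<in> carrier (presented_group R)"
  then show "\<one>\<^bsub>presented_group R\<^esub> \<otimes>\<^bsub>presented_group R\<^esub> x = x"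
    by (auto simp: 1 C mult_pres_class)
  show "\<exists>y\<in>carrier (presented_group R). y \<otimes>\<^bsub>presented_group R\<^esub> x = \<one>\<^bsub>presented_group R\<^esub>"
    using x pres_eq_inverse[of R] by (auto simp: 1 C mult_pres_class pres_class_eq_iff)
  assume y: "y \<in> carrier (presented_group R)"
  show "x \<otimes>\<^bsub>presented_group R\<^esub> y \<in> carrier (presented_group R)"
    using x y by (auto simp: C mult_pres_class)
  assume z: "z \<in> carrier (presented_group R)"
  show "x \<otimes>\<^bsub>presented_group R\<^esub> y \<otimes>\<^bsub>presented_group R\<^esub> z =
        x \<otimes>\<^bsub>presented_group R\<^esub> (y \<otimes>\<^bsub>presented_group R\<^esub> z)"
    using x y z by (auto simp: C mult_pres_class)
qed


section \<open>The semidihedral group of order \<open>8 n\<close>\<close>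

datatype sd_gen = Gen_a | Gen_b

definition sd_relations :: "nat \<Rightarrow> (sd_gen gword \<times> sd_gen gword) set" where
  "sd_relations n =
     (let a = (Gen_a, True); b = (Gen_b, True) in
      {(replicate (4 * n) a, []),
       ([b, b], []),
       ([b, a], replicate (2 * n - 1) a @ [b])})"

text \<open>Intended for \<open>n \<ge> 1\<close>; for \<open>n = 0\<close> the exponent \<open>2 * n - 1\<close> is truncated.\<close>

definition SD8 :: "nat \<Rightarrow> sd_gen gword set monoid" where
  "SD8 n = presented_group (sd_relations n)"


section \<open>Commuting graphs and covering numbers\<close>

text \<open>A simple graph is a set of vertices together with a set of two-element sets of vertices.\<close>

type_synonym 'a sgraph = "'a set \<times> 'a set set"

definition commuting_graph :: "('a, 'b) monoid_scheme \<Rightarrow> 'a sgraph" where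
  "commuting_graph G =
     (carrier G,
      {{x, y} |x y. x \<in> carrier G \<and> y \<in> carrier G \<and> x \<noteq> y \<and> x \<otimes>\<^bsub>G\<^esub> y = y \<otimes>\<^bsub>G\<^esub> x})"

definition vertex_cover :: "'a sgraph \<Rightarrow> 'a set \<Rightarrow> bool" where
  "vertex_cover \<Gamma> C \<longleftrightarrow> C \<subseteq> fst \<Gamma> \<and> (\<forall>e\<in>snd \<Gamma>. e \<inter> C \<noteq> {})"

definition edge_cover :: "'a sgraph \<Rightarrow> 'a set set \<Rightarrow> bool" where
  "edge_cover \<Gamma> F \<longleftrightarrow> F \<subseteq> snd \<Gamma> \<and> (\<forall>v\<in>fst \<Gamma>. \<exists>e\<in>F. v \<in> e)"

text \<open>
  Finiteness of the covers is required because \<open>card\<close> is \<open>0\<close> on infinite sets. The numbers are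
  meaningful only for graphs that have a finite cover.
\<close>

definition vertex_covering_number :: "'a sgraph \<Rightarrow> nat" where
  "vertex_covering_number \<Gamma> = (LEAST k. \<exists>C. vertex_cover \<Gamma> C \<and> finite C \<and> card C = k)"

definition edge_covering_number :: "'a sgraph \<Rightarrow> nat" where
  "edge_covering_number \<Gamma> = (LEAST k. \<exists>F. edge_cover \<Gamma> F \<and> finite F \<and> card F = k)"

end

theory Submission
  imports Defs "HOL-Number_Theory.Cong"
begin

text \<open>
  Every element of \<open>SD\<^bsub>8n\<^esub>\<close> is \<open>a\<^sup>i b\<^sup>p\<close> with \<open>i\<close> unique modulo \<open>4n\<close> and \<open>p\<close> unique modulo 2;
  uniqueness holds because a word determines a pair \<open>(i, p)\<close> that respects the relations.
  For \<open>n \<ge> 2\<close>, two elements \<open>a\<^sup>i b\<close> and \<open>a\<^sup>j b\<close> commute iff \<open>i \<equiv> j\<close> modulo \<open>d\<close>, where \<open>d = 2n\<close> for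
  even \<open>n\<close> and \<open>d = n\<close> for odd \<open>n\<close>, while \<open>a\<close> commutes with no \<open>a\<^sup>i b\<close>. Hence the powers of \<open>a\<close>
  and the \<open>d\<close> residue classes of elements \<open>a\<^sup>i b\<close> are \<open>d + 1\<close> cliques covering the graph, and
  \<open>a, b, ab, \<dots>, a\<^bsup>d - 1\<^esup>b\<close> is an independent set of the same size. Its complement is
  therefore a minimum vertex cover. Multiplication by the central involution
  \<open>a\<^bsup>2n\<^esup>\<close> pairs the vertices into a perfect matching, which is a minimum edge cover.
\<close>

section \<open>Covering numbers of finite graphs\<close>

text \<open>Weak duality. The complement of an independent set is a vertex cover. Conversely, two
  uncovered vertices of a cover never lie in a common clique, so sending each uncovered vertex to a
  clique that contains it is injective, and at most \<open>card \<K>\<close> vertices are uncovered.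
  The cliques may overlap.\<close>

lemma vertex_covering_number_eqI:
  assumes "finite V"
    and indep: "I \<subseteq> V" "\<And>e. e \<in> E \<Longrightarrow> \<not> e \<subseteq> I"
    and edges: "\<And>e. e \<in> E \<Longrightarrow> e \<subseteq> V"
    and cliques: "V \<subseteq> \<Union>\<K>" "\<And>K x y. K \<in> \<K> \<Longrightarrow> x \<in> K \<Longrightarrow> y \<in> K \<Longrightarrow> x \<noteq> y \<Longrightarrow> {x, y} \<in> E"
    and "finite \<K>" "card \<K> \<le> card I"
  shows "vertex_covering_number (V, E) = card V - card I"
  unfolding vertex_covering_number_def
proof (rule Least_equality)
  have "vertex_cover (V, E) (V - I)"
    using edges indep unfolding vertex_cover_def by fastforce
  moreover have "card (V - I) = card V - card I"
    using assms by (meson card_Diff_subset finite_subset)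
  ultimately show "\<exists>C. vertex_cover (V, E) C \<and> finite C \<and> card C = card V - card I"
    using \<open>finite V\<close> by blast
next
  fix k assume "\<exists>C. vertex_cover (V, E) C \<and> finite C \<and> card C = k"
  then obtain C where C: "C \<subseteq> V" "\<And>e. e \<in> E \<Longrightarrow> e \<inter> C \<noteq> {}" "finite C" "card C = k"
    by (auto simp: vertex_cover_def)
  from cliques(1) have "\<forall>v\<in>V. \<exists>K\<in>\<K>. v \<in> K" by blast
  then obtain f where f: "\<And>v. v \<in> V \<Longrightarrow> f v \<in> \<K>" "\<And>v. v \<in> V \<Longrightarrow> v \<in> f v" by metis
  have "inj_on f (V - C)"
  proof (rule inj_onI, rule ccontr)
    fix x y assume xy: "x \<in> V - C" "y \<in> V - C" "f x = f y" "x \<noteq> y"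
    then have "{x, y} \<in> E" using cliques(2)[of "f x" x y] f by auto
    with C(2) xy show False by blast
  qed
  moreover have "f ` (V - C) \<subseteq> \<K>" using f by auto
  ultimately have "card (V - C) \<le> card \<K>" using \<open>finite \<K>\<close> by (rule card_inj_on_le)
  with \<open>card \<K> \<le> card I\<close> C show "card V - card I \<le> k" by (simp add: card_Diff_subset)
qed

text \<open>An edge covers only two vertices, so a cover needs at least half as many edges as there
  are vertices. The edges \<open>{v, h v}\<close> form a perfect matching and attain this
  bound.\<close>

lemma edge_covering_number_eqI:
  assumes "finite V"
    and edges: "\<And>e. e \<in> E \<Longrightarrow> e \<subseteq> V" "\<And>e. e \<in> E \<Longrightarrow> card e = 2"
    and matching: "\<And>v. v \<in> V \<Longrightarrow> {v, h v} \<in> E" "\<And>v. v \<in> V \<Longrightarrow> h (h v) = v"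
    and card: "card V = 2 * m"
  shows "edge_covering_number (V, E) = m"
  unfolding edge_covering_number_def
proof (rule Least_equality)
  let ?F = "(\<lambda>v. {v, h v}) ` V"
  have un: "\<Union>?F = V" using matching(1) edges(1) by blast
  have "2 * card ?F = card (\<Union>?F)"
  proof (rule card_partition)
    show "finite ?F" using \<open>finite V\<close> by simp
    show "finite (\<Union>?F)" unfolding un by fact
    show "card c = 2" if "c \<in> ?F" for c using that matching(1) edges(2) by blast
    show "c1 \<inter> c2 = {}" if c: "c1 \<in> ?F" "c2 \<in> ?F" "c1 \<noteq> c2" for c1 c2
    proof -
      \<comment> \<open>Blocks that share a vertex are equal, since \<open>h\<close> is an
        involution.\<close>
      obtain v w where "v \<in> V" "w \<in> V" "c1 = {v, h v}" "c2 = {w, h w}" using c by blast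
      moreover from this have "h (h v) = v" "h (h w) = w" using matching(2) by auto
      ultimately show ?thesis using c(3) by (metis disjoint_iff doubleton_eq_iff empty_iff insert_iff)
    qed
  qed
  then have "card ?F = m" using card un by simp
  moreover have "edge_cover (V, E) ?F"
    using matching(1) by (auto simp: edge_cover_def)
  ultimately show "\<exists>F. edge_cover (V, E) F \<and> finite F \<and> card F = m"
    using \<open>finite V\<close> by blast
next
  fix k assume "\<exists>F. edge_cover (V, E) F \<and> finite F \<and> card F = k"
  then obtain F where F: "F \<subseteq> E" "V \<subseteq> \<Union>F" "finite F" "card F = k"
    by (metis UnionI edge_cover_def fst_conv snd_conv subsetI)
  have "\<Union>F \<subseteq> V" using F(1) edges(1) by blast
  with F(2) have "card V = card (\<Union>F)" by (simp add: subset_antisym)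
  also have "\<dots> \<le> (\<Sum>e\<in>F. card e)" by (rule card_Union_le_sum_card)
  also have "\<dots> = 2 * k" using F edges(2) by (simp add: subset_iff)
  finally show "m \<le> k" using card by simp
qed


section \<open>Normal forms in the semidihedral group\<close>

abbreviation sd_eq :: "nat \<Rightarrow> sd_gen gword \<Rightarrow> sd_gen gword \<Rightarrow> bool" where
  "sd_eq n \<equiv> pres_eq (sd_relations n)"

text \<open>
  Moving every \<open>b\<close> to the right by \<open>b a = a\<^bsup>2n - 1\<^esup> b\<close> turns a word \<open>w\<close> into \<open>a\<^sup>i b\<^sup>p\<close> with
  \<open>i = a_exp n w\<close> and \<open>p = b_count w\<close>.
\<close>

fun b_count :: "sd_gen gword \<Rightarrow> nat" where
  "b_count [] = 0"
| "b_count ((Gen_a, s) # w) = b_count w"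
| "b_count ((Gen_b, s) # w) = Suc (b_count w)"

fun a_exp :: "nat \<Rightarrow> sd_gen gword \<Rightarrow> int" where
  "a_exp n [] = 0"
| "a_exp n ((Gen_a, s) # w) = (if s then 1 else - 1) + a_exp n w"
| "a_exp n ((Gen_b, s) # w) = (2 * int n - 1) * a_exp n w"

definition sd_nf :: "nat \<Rightarrow> nat \<Rightarrow> sd_gen gword" where
  "sd_nf i p = replicate i (Gen_a, True) @ replicate p (Gen_b, True)"

lemma b_count_append [simp]: "b_count (u @ v) = b_count u + b_count v"
  by (induction u rule: b_count.induct) auto

lemma a_exp_append [simp]: "a_exp n (u @ v) = a_exp n u + (2 * int n - 1) ^ b_count u * a_exp n v"
  by (induction u rule: b_count.induct) (auto simp: algebra_simps)

lemma b_count_replicate [simp]: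
  "b_count (replicate m (Gen_a, s)) = 0" "b_count (replicate m (Gen_b, s)) = m"
  by (induction m) auto

lemma a_exp_replicate [simp]:
  "a_exp n (replicate m (Gen_a, True)) = int m" "a_exp n (replicate m (Gen_b, s)) = 0"
  by (induction m) auto

lemma b_count_sd_nf [simp]: "b_count (sd_nf i p) = p"
  and a_exp_sd_nf [simp]: "a_exp n (sd_nf i p) = int i"
  by (simp_all add: sd_nf_def)

section \<open>Invariants of words under the relations\<close>

lemma twist_square_cong: "[(2 * int n - 1) ^ 2 = 1] (mod 4 * int n)"
proof -
  have "(2 * int n - 1) ^ 2 - 1 = 4 * int n * (int n - 1)"
    by (simp add: power2_eq_square algebra_simps)
  then show ?thesis by (simp add: cong_iff_dvd_diff)
qed

text \<open>Moving \<open>b\<close> past a power of \<open>a\<close> multiplies the exponent by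
  \<open>2 * n - 1\<close>. Doing so twice changes nothing modulo \<open>4 * n\<close>, so only the
  parity of the number of moves matters.\<close>

lemma twist_power_cong:
  assumes "even p = even q"
  shows "[(2 * int n - 1) ^ p = (2 * int n - 1) ^ q] (mod 4 * int n)"
proof -
  let ?k = "2 * int n - 1"
  have *: "[?k ^ r = ?k ^ (r mod 2)] (mod 4 * int n)" for r
  proof -
    have "?k ^ r = (?k ^ 2) ^ (r div 2) * ?k ^ (r mod 2)"
      by (simp flip: power_mult power_add)
    also have "[\<dots> = 1 ^ (r div 2) * ?k ^ (r mod 2)] (mod 4 * int n)"
      by (intro cong_mult cong_pow twist_square_cong cong_refl)
    finally show ?thesis by simp
  qed
  from assms have "p mod 2 = q mod 2" by presburger
  with *[of p] have "[?k ^ p = ?k ^ (q mod 2)] (mod 4 * int n)" by simp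
  from cong_trans[OF this cong_sym[OF *]] show ?thesis .
qed

text \<open>The uniqueness half of the normal form: each rule that generates \<open>pres_eq\<close>
  preserves both invariants.\<close>

lemma sd_eq_invariant:
  assumes "n \<ge> 1" "sd_eq n u v"
  shows "[a_exp n u = a_exp n v] (mod 4 * int n) \<and> even (b_count u) = even (b_count v)"
  using assms(2)
proof induction
  case (trans u v w)
  then show ?case using cong_trans[of "a_exp n u" "a_exp n v" _ "a_exp n w"] by simp
next
  case (append u u' v v')
  \<comment> \<open>The exponent of \<open>v\<close> is scaled by a power of the twist given by
    \<open>b_count u\<close>; the induction hypothesis on parities makes this power agree with the
    one for \<open>u'\<close>.\<close>
  then show ?case
    by (simp add: cong_add cong_mult twist_power_cong)
next
  case (cancel x s)
  then show ?case by (cases x) auto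
next
  case (relation u v)
  \<comment> \<open>For \<open>n \<ge> 1\<close> the natural number \<open>2 * n - 1\<close> in the
    relation is not truncated and agrees with the integer in \<open>a_exp\<close>.\<close>
  then show ?case
    using \<open>n \<ge> 1\<close> by (auto simp: sd_relations_def Let_def cong_iff_dvd_diff)
qed (simp_all add: cong_sym)

section \<open>Rewriting words to normal form\<close>

lemma sd_eq_relations:
  shows sd_eq_a_power: "sd_eq n (replicate (4 * n) (Gen_a, True)) []"
    and sd_eq_b_square: "sd_eq n [(Gen_b, True), (Gen_b, True)] []"
    and sd_eq_b_a: "sd_eq n [(Gen_b, True), (Gen_a, True)]
          (replicate (2 * n - 1) (Gen_a, True) @ [(Gen_b, True)])"
  by (rule pres_eq.relation; simp add: sd_relations_def Let_def)+

text \<open>From \<open>x = x (y z) = (x y) z = z\<close>. It serves to replace formal inverses of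
  generators by positive words, since normal forms contain no negative letters.\<close>

lemma pres_eq_left_inverse_unique:
  assumes "pres_eq R (x @ y) []" "pres_eq R (y @ z) []"
  shows "pres_eq R x z"
proof -
  have "pres_eq R (x @ (y @ z)) (x @ [])"
    using assms(2) by (rule pres_eq.append[OF pres_eq.refl])
  moreover have "pres_eq R ((x @ y) @ z) ([] @ z)"
    using assms(1) by (rule pres_eq.append[OF _ pres_eq.refl])
  ultimately show ?thesis by (simp, metis pres_eq.sym pres_eq.trans)
qed

lemma sd_eq_a_inverse:
  assumes "n \<ge> 1"
  shows "sd_eq n [(Gen_a, False)] (replicate (4 * n - 1) (Gen_a, True))"
proof (rule pres_eq_left_inverse_unique)
  show "sd_eq n ([(Gen_a, False)] @ [(Gen_a, True)]) []"
    using pres_eq.cancel[of _ Gen_a False] by simp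
  have "[(Gen_a, True)] @ replicate (4 * n - 1) (Gen_a, True) = replicate (4 * n) (Gen_a, True)"
    using assms by (cases "4 * n") auto
  with sd_eq_a_power show "sd_eq n ([(Gen_a, True)] @ replicate (4 * n - 1) (Gen_a, True)) []"
    by metis
qed

lemma sd_eq_b_inverse: "sd_eq n [(Gen_b, False)] [(Gen_b, True)]"
  by (rule pres_eq_left_inverse_unique[where y = "[(Gen_b, True)]"])
    (use pres_eq.cancel[of _ Gen_b False] sd_eq_b_square in auto)

lemma sd_eq_b_a_power:
  "sd_eq n ((Gen_b, True) # replicate i (Gen_a, True))
     (replicate ((2 * n - 1) * i) (Gen_a, True) @ [(Gen_b, True)])"
proof (induction i)
  case (Suc i)
  let ?a = "\<lambda>m. replicate m (Gen_a, True)" and ?b = "(Gen_b, True)"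
  have "sd_eq n ([?b, (Gen_a, True)] @ ?a i) ((?a (2 * n - 1) @ [?b]) @ ?a i)"
    by (intro pres_eq.append pres_eq.refl sd_eq_b_a)
  moreover have "sd_eq n (?a (2 * n - 1) @ (?b # ?a i)) (?a (2 * n - 1) @ (?a ((2 * n - 1) * i) @ [?b]))"
    by (intro pres_eq.append pres_eq.refl Suc)
  ultimately have "sd_eq n ([?b, (Gen_a, True)] @ ?a i) (?a (2 * n - 1) @ (?a ((2 * n - 1) * i) @ [?b]))"
    by (auto intro: pres_eq.trans)
  then show ?case by (simp add: replicate_add)
qed (simp add: pres_eq.refl)

text \<open>The existence half of the normal form. A letter put in front of
  \<open>a\<^sup>i b\<^sup>p\<close> is first made positive; an \<open>a\<close> is then absorbed,
  and a \<open>b\<close> is moved past \<open>a\<^sup>i\<close>. Exponents are not reduced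
  yet.\<close>

lemma ex_sd_nf:
  assumes "n \<ge> 1"
  shows "\<exists>i p. sd_eq n w (sd_nf i p)"
proof (induction w)
  case Nil
  show ?case by (rule exI[of _ 0], rule exI[of _ 0]) (simp add: sd_nf_def pres_eq.refl)
next
  case (Cons g w)
  then obtain i p where w: "sd_eq n w (sd_nf i p)" by blast
  have step: "sd_eq n (g # w) (x @ sd_nf i p)" if "sd_eq n [g] x" for x
    using pres_eq.append[OF that w] by simp
  have a: "replicate m (Gen_a, True) @ sd_nf i p = sd_nf (m + i) p" for m
    by (simp add: sd_nf_def replicate_add)
  have b: "sd_eq n ([(Gen_b, True)] @ sd_nf i p) (sd_nf ((2 * n - 1) * i) (Suc p))"
    using pres_eq.append[OF sd_eq_b_a_power pres_eq.refl, of n i "replicate p (Gen_b, True)"]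
    by (simp add: sd_nf_def)
  consider "g = (Gen_a, True)" | "g = (Gen_a, False)" | "g = (Gen_b, True)" | "g = (Gen_b, False)"
    by (cases g) (metis (full_types) sd_gen.exhaust)
  then show ?case
  proof cases
    case 1
    then show ?thesis using step[OF pres_eq.refl] a[of 1] by auto
  next
    case 2
    then show ?thesis using step[of "replicate (4 * n - 1) (Gen_a, True)"] sd_eq_a_inverse[OF assms] a
      by auto
  next
    case 3
    then show ?thesis using pres_eq.trans[OF step[OF pres_eq.refl]] b by blast
  next
    case 4
    then show ?thesis using pres_eq.trans[OF step] sd_eq_b_inverse b by blast
  qed
qed

lemma pres_eq_replicate_mod:
  assumes "pres_eq R (replicate m x) []"
  shows "pres_eq R (replicate i x) (replicate (i mod m) x)"
proof -
  have "pres_eq R (replicate (m * q) x) []" for q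
  proof (induction q)
    case (Suc q)
    from pres_eq.append[OF assms Suc] show ?case by (simp add: replicate_add)
  qed (simp add: pres_eq.refl)
  from pres_eq.append[OF this pres_eq.refl, of "i div m" "replicate (i mod m) x"]
  show ?thesis by (simp flip: replicate_add)
qed

lemma sd_nf_mod: "sd_eq n (sd_nf i p) (sd_nf (i mod (4 * n)) (p mod 2))"
  unfolding sd_nf_def
  by (intro pres_eq.append pres_eq_replicate_mod)
    (use sd_eq_a_power sd_eq_b_square in \<open>auto simp: numeral_2_eq_2\<close>)

text \<open>This solves the word problem. Words with equal invariants have normal forms with equal
  invariants, and these become the same word once exponents are reduced modulo \<open>4 * n\<close>
  and 2.\<close>

lemma sd_eq_iff:
  assumes "n \<ge> 1"
  shows "sd_eq n u v \<longleftrightarrow>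
    [a_exp n u = a_exp n v] (mod 4 * int n) \<and> even (b_count u) = even (b_count v)"
proof
  assume *: "[a_exp n u = a_exp n v] (mod 4 * int n) \<and> even (b_count u) = even (b_count v)"
  obtain i p j q where u: "sd_eq n u (sd_nf i p)" and v: "sd_eq n v (sd_nf j q)"
    using ex_sd_nf[OF assms] by meson
  have "[int i = int j] (mod int (4 * n))" and pq: "even p = even q"
    using sd_eq_invariant[OF assms u] sd_eq_invariant[OF assms v] *
    by (simp_all, metis cong_sym cong_trans)
  then have "i mod (4 * n) = j mod (4 * n)"
    unfolding cong_int_iff by (simp add: cong_def)
  moreover from pq have "p mod 2 = q mod 2" by presburger
  ultimately have "sd_eq n (sd_nf i p) (sd_nf j q)"
    using sd_nf_mod[of n i p] sd_nf_mod[of n j q] by (metis pres_eq.sym pres_eq.trans)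
  with u v show "sd_eq n u v" by (metis pres_eq.sym pres_eq.trans)
qed (rule sd_eq_invariant[OF assms])

section \<open>Group elements and their commutation\<close>

text \<open>The group element \<open>a\<^sup>i b\<^sup>p\<close>. Exponents are arbitrary naturals,
  so products and powers need no reduction and an element has many names.\<close>

definition sd_elem :: "nat \<Rightarrow> nat \<Rightarrow> nat \<Rightarrow> sd_gen gword set" where
  "sd_elem n i p = pres_class (sd_relations n) (sd_nf i p)"

lemma sd_elem_eq_iff:
  assumes "n \<ge> 1"
  shows "sd_elem n i p = sd_elem n j q \<longleftrightarrow> [i = j] (mod 4 * n) \<and> even p = even q"
  using assms cong_int_iff[of i j "4 * n"]
  by (simp add: sd_elem_def pres_class_eq_iff sd_eq_iff)

text \<open>Both products contain \<open>p + q\<close> letters \<open>b\<close>, so only the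
  exponents of \<open>a\<close> remain to be compared.\<close>

lemma sd_elem_commute_iff:
  assumes "n \<ge> 1"
  shows "sd_elem n i p \<otimes>\<^bsub>SD8 n\<^esub> sd_elem n j q = sd_elem n j q \<otimes>\<^bsub>SD8 n\<^esub> sd_elem n i p \<longleftrightarrow>
    [int i + (2 * int n - 1) ^ p * int j = int j + (2 * int n - 1) ^ q * int i] (mod 4 * int n)"
  using assms by (auto simp: sd_elem_def SD8_def mult_pres_class pres_class_eq_iff sd_eq_iff)

lemma carrier_SD8:
  assumes "n \<ge> 1"
  shows "carrier (SD8 n) = (\<lambda>(i, p). sd_elem n i p) ` ({..<4 * n} \<times> {..<2})"
proof (intro equalityI subsetI)
  fix x assume "x \<in> carrier (SD8 n)"
  then obtain w where w: "x = pres_class (sd_relations n) w"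
    by (auto simp: SD8_def presented_group_def)
  obtain i p where "sd_eq n w (sd_nf i p)" using ex_sd_nf[OF assms] by blast
  with w have "x = sd_elem n (i mod (4 * n)) (p mod 2)"
    using sd_nf_mod[of n i p] unfolding sd_elem_def by (metis pres_class_eq_iff)
  then show "x \<in> (\<lambda>(i, p). sd_elem n i p) ` ({..<4 * n} \<times> {..<2})"
    using assms by force
qed (auto simp: SD8_def presented_group_def sd_elem_def)

lemma sd_elem_in_carrier [simp]: "sd_elem n i p \<in> carrier (SD8 n)"
  by (auto simp: SD8_def presented_group_def sd_elem_def)

lemma card_carrier_SD8:
  assumes "n \<ge> 1"
  shows "card (carrier (SD8 n)) = 8 * n"
proof -
  have "inj_on (\<lambda>(i, p). sd_elem n i p) ({..<4 * n} \<times> {..<2})"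
  proof (rule inj_onI)
    fix x y assume xy: "x \<in> {..<4 * n} \<times> {..<2::nat}" "y \<in> {..<4 * n} \<times> {..<2::nat}"
      "(\<lambda>(i, p). sd_elem n i p) x = (\<lambda>(i, p). sd_elem n i p) y"
    obtain i p j q where [simp]: "x = (i, p)" "y = (j, q)" by (cases x, cases y)
    have "[i = j] (mod 4 * n)" "even p = even q"
      using xy(3) sd_elem_eq_iff[OF assms] by auto
    moreover have "i < 4 * n" "j < 4 * n" "p < 2" "q < 2" using xy by auto
    ultimately show "x = y"
      by (auto simp: cong_def less_2_cases_iff)
  qed
  then show ?thesis by (simp add: carrier_SD8[OF assms] card_image card_cartesian_product)
qed

lemma finite_carrier_SD8: "n \<ge> 1 \<Longrightarrow> finite (carrier (SD8 n))"
  by (simp add: carrier_SD8)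

lemma sd_elem_rotations_commute:
  assumes "n \<ge> 1"
  shows "sd_elem n i 0 \<otimes>\<^bsub>SD8 n\<^esub> sd_elem n j 0 = sd_elem n j 0 \<otimes>\<^bsub>SD8 n\<^esub> sd_elem n i 0"
  by (simp add: sd_elem_commute_iff[OF assms] add.commute)

text \<open>Commuting would make \<open>4 * n\<close> divide \<open>2 * n - 2\<close>, which lies
  strictly between 0 and \<open>4 * n\<close> when \<open>n \<ge> 2\<close>.\<close>

lemma sd_elem_rotation_not_commute:
  assumes "n \<ge> 2"
  shows "sd_elem n 1 0 \<otimes>\<^bsub>SD8 n\<^esub> sd_elem n i 1 \<noteq> sd_elem n i 1 \<otimes>\<^bsub>SD8 n\<^esub> sd_elem n 1 0"
proof
  assume "sd_elem n 1 0 \<otimes>\<^bsub>SD8 n\<^esub> sd_elem n i 1 = sd_elem n i 1 \<otimes>\<^bsub>SD8 n\<^esub> sd_elem n 1 0"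
  then have "[1 + int i = int i + (2 * int n - 1)] (mod 4 * int n)"
    using assms by (simp add: sd_elem_commute_iff)
  then have "4 * int n dvd (int i + (2 * int n - 1)) - (1 + int i)"
    using cong_iff_dvd_diff cong_sym by blast
  then have "4 * int n dvd 2 * int n - 2" by simp
  with assms show False using zdvd_not_zless[of "2 * int n - 2" "4 * int n"] by simp
qed

text \<open>Commuting means that \<open>2 * n\<close> divides \<open>(n - 1) * (j - i)\<close>. For
  even \<open>n\<close> the factor \<open>n - 1\<close> is coprime to \<open>2 * n\<close> and drops
  out. For odd \<open>n\<close> it absorbs the 2, and its half is coprime to
  \<open>n\<close>.\<close>

lemma sd_elem_reflections_commute_iff:
  assumes "n \<ge> 1"
  shows "sd_elem n i 1 \<otimes>\<^bsub>SD8 n\<^esub> sd_elem n j 1 = sd_elem n j 1 \<otimes>\<^bsub>SD8 n\<^esub> sd_elem n i 1 \<longleftrightarrow>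
    [i = j] (mod (if even n then 2 * n else n))"
proof -
  have "sd_elem n i 1 \<otimes>\<^bsub>SD8 n\<^esub> sd_elem n j 1 = sd_elem n j 1 \<otimes>\<^bsub>SD8 n\<^esub> sd_elem n i 1 \<longleftrightarrow>
      4 * int n dvd (int i + (2 * int n - 1) * int j) - (int j + (2 * int n - 1) * int i)"
    using assms by (simp add: sd_elem_commute_iff cong_iff_dvd_diff)
  also have "(int i + (2 * int n - 1) * int j) - (int j + (2 * int n - 1) * int i) =
      2 * ((int n - 1) * (int j - int i))"
    by (simp add: algebra_simps)
  also have "4 * int n dvd \<dots> \<longleftrightarrow> 2 * int n dvd (int n - 1) * (int j - int i)"
    using dvd_mult_cancel_left[of 2 "2 * int n"] by simp
  also have "\<dots> \<longleftrightarrow> int (if even n then 2 * n else n) dvd int j - int i"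
  proof (cases "even n")
    case True
    then have "coprime (int n - 1) (2 * int n)"
      by (simp add: coprime_right_2_iff_odd coprime_diff_one_left)
    then have "coprime (2 * int n) (int n - 1)" by (rule coprime_commute[THEN iffD1])
    then show ?thesis using True by (simp add: coprime_dvd_mult_right_iff)
  next
    case False
    then obtain k where "n = 2 * k + 1" by (rule oddE)
    then obtain m where m: "int n - 1 = 2 * m" by fastforce
    have "coprime (int n - 1) (int n)" by (rule coprime_diff_one_left)
    then have "coprime (int n) m" by (simp add: m coprime_commute)
    moreover have "2 * int n dvd (int n - 1) * (int j - int i) \<longleftrightarrow> int n dvd m * (int j - int i)"
      by (simp add: m mult.assoc)
    ultimately show ?thesis using False by (simp add: coprime_dvd_mult_right_iff)
  qed
  also have "\<dots> \<longleftrightarrow> [i = j] (mod (if even n then 2 * n else n))"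
    by (metis cong_iff_dvd_diff cong_int_iff cong_sym_eq)
  finally show ?thesis .
qed


section \<open>The covering numbers of the commuting graph\<close>

lemma edge_covering_number_SD8:
  assumes "n \<ge> 1"
  shows "edge_covering_number (commuting_graph (SD8 n)) = 4 * n"
  unfolding commuting_graph_def
proof (rule edge_covering_number_eqI)
  interpret group "SD8 n" unfolding SD8_def by (rule group_presented_group)
  let ?z = "sd_elem n (2 * n) 0"
  show "card (carrier (SD8 n)) = 2 * (4 * n)" by (simp add: card_carrier_SD8[OF assms])
  have one: "sd_elem n 0 0 = \<one>\<^bsub>SD8 n\<^esub>"
    by (simp add: sd_elem_def sd_nf_def SD8_def presented_group_def)
  have "?z \<otimes>\<^bsub>SD8 n\<^esub> ?z = sd_elem n (4 * n) 0"
    by (simp add: sd_elem_def SD8_def mult_pres_class sd_nf_def flip: replicate_add)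
  also have "\<dots> = \<one>\<^bsub>SD8 n\<^esub>"
    by (simp add: sd_elem_eq_iff[OF assms] cong_def flip: one)
  finally have zz: "?z \<otimes>\<^bsub>SD8 n\<^esub> ?z = \<one>\<^bsub>SD8 n\<^esub>" .
  have z: "?z \<noteq> \<one>\<^bsub>SD8 n\<^esub>"
    using assms by (simp add: sd_elem_eq_iff cong_def flip: one)
  have central: "?z \<otimes>\<^bsub>SD8 n\<^esub> x = x \<otimes>\<^bsub>SD8 n\<^esub> ?z" if x: "x \<in> carrier (SD8 n)" for x
  proof -
    obtain i p where [simp]: "x = sd_elem n i p" and "p < 2"
      using x by (auto simp: carrier_SD8[OF assms])
    then consider "p = 0" | "p = 1" by linarith
    then show ?thesis
    proof cases
      case 2
      \<comment> \<open>The two exponents of \<open>a\<close> in the products of \<open>?z\<close>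
        with \<open>a\<^sup>i b\<close> differ by a multiple of \<open>4 * n\<close>.\<close>
      have "(int i + (2 * int n - 1) * (2 * int n)) - (2 * int n + int i) = 4 * int n * (int n - 1)"
        by (simp add: algebra_simps)
      then have "[2 * int n + int i = int i + (2 * int n - 1) * (2 * int n)] (mod 4 * int n)"
        by (metis cong_iff_dvd_diff cong_sym dvd_triv_left)
      then show ?thesis by (simp add: sd_elem_commute_iff[OF assms] 2)
    qed (simp add: sd_elem_rotations_commute[OF assms])
  qed
  fix x assume x: "x \<in> carrier (SD8 n)"
  show "?z \<otimes>\<^bsub>SD8 n\<^esub> (?z \<otimes>\<^bsub>SD8 n\<^esub> x) = x"
    using x zz by (simp flip: m_assoc)
  \<comment> \<open>Cancelling \<open>x\<close> would give \<open>?z = \<one>\<close>, so the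
    pairing has no fixed vertex.\<close>
  have "x \<noteq> ?z \<otimes>\<^bsub>SD8 n\<^esub> x"
    using x z r_cancel_one' by auto
  moreover have "x \<otimes>\<^bsub>SD8 n\<^esub> (?z \<otimes>\<^bsub>SD8 n\<^esub> x) = (?z \<otimes>\<^bsub>SD8 n\<^esub> x) \<otimes>\<^bsub>SD8 n\<^esub> x"
    using x central[OF x] by (metis m_assoc sd_elem_in_carrier)
  moreover have "?z \<otimes>\<^bsub>SD8 n\<^esub> x \<in> carrier (SD8 n)" using x by simp
  ultimately show "{x, ?z \<otimes>\<^bsub>SD8 n\<^esub> x} \<in> {{x, y} |x y. x \<in> carrier (SD8 n) \<and>
      y \<in> carrier (SD8 n) \<and> x \<noteq> y \<and> x \<otimes>\<^bsub>SD8 n\<^esub> y = y \<otimes>\<^bsub>SD8 n\<^esub> x}"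
    using x by blast
next
  fix e assume "e \<in> {{x, y} |x y. x \<in> carrier (SD8 n) \<and>
      y \<in> carrier (SD8 n) \<and> x \<noteq> y \<and> x \<otimes>\<^bsub>SD8 n\<^esub> y = y \<otimes>\<^bsub>SD8 n\<^esub> x}"
  then obtain x y where "e = {x, y}" "x \<in> carrier (SD8 n)" "y \<in> carrier (SD8 n)" "x \<noteq> y"
    by blast
  then show "e \<subseteq> carrier (SD8 n)" "card e = 2" by simp_all
qed (rule finite_carrier_SD8[OF assms])

text \<open>For \<open>n = 1\<close> the twist \<open>2 * n - 1\<close> is 1, so the group is
  abelian and its graph is complete on eight vertices: one clique, and a single vertex as
  independent set.\<close>

lemma vertex_covering_number_SD8_1: "vertex_covering_number (commuting_graph (SD8 1)) = 7"
proof -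
  let ?V = "carrier (SD8 1)"
  have comm: "x \<otimes>\<^bsub>SD8 1\<^esub> y = y \<otimes>\<^bsub>SD8 1\<^esub> x" if xy: "x \<in> ?V" "y \<in> ?V" for x y
  proof -
    obtain i p j q where "x = sd_elem 1 i p" "y = sd_elem 1 j q"
      using xy by (auto simp: carrier_SD8)
    then show ?thesis by (simp add: sd_elem_commute_iff add.commute)
  qed
  have "vertex_covering_number (commuting_graph (SD8 1)) = card ?V - card {sd_elem 1 0 0}"
    unfolding commuting_graph_def
  proof (rule vertex_covering_number_eqI[where \<K> = "{?V}"])
    fix K x y assume "K \<in> {?V}" "x \<in> K" "y \<in> K" "x \<noteq> y"
    then show "{x, y} \<in> {{x, y} |x y. x \<in> ?V \<and> y \<in> ?V \<and> x \<noteq> y \<and>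
        x \<otimes>\<^bsub>SD8 1\<^esub> y = y \<otimes>\<^bsub>SD8 1\<^esub> x}"
      using comm by blast
  qed (use finite_carrier_SD8 in auto)
  then show ?thesis by (simp add: card_carrier_SD8)
qed

text \<open>Substituting \<open>d\<close> gives \<open>6 * n - 1\<close> for even and
  \<open>7 * n - 1\<close> for odd \<open>n\<close>.\<close>

lemma vertex_covering_number_SD8:
  assumes "n \<ge> 2"
  defines "d \<equiv> if even n then 2 * n else n"
  shows "vertex_covering_number (commuting_graph (SD8 n)) = 8 * n - (d + 1)"
proof -
  let ?V = "carrier (SD8 n)"
  define I where "I = insert (sd_elem n 1 0) ((\<lambda>i. sd_elem n i 1) ` {..<d})"
  define B where "B r = {sd_elem n i 1 |i. i mod d = r}" for r
  define \<K> where "\<K> = insert (range (\<lambda>i. sd_elem n i 0)) (B ` {..<d})"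
  \<comment> \<open>The bound \<open>d \<le> 4 * n\<close> keeps the elements
    \<open>a\<^sup>i b\<close> with \<open>i < d\<close> distinct.\<close>
  have n: "n \<ge> 1" and d: "0 < d" "d \<le> 4 * n" using assms(1) by (auto simp: d_def)
  have comm: "sd_elem n i 1 \<otimes>\<^bsub>SD8 n\<^esub> sd_elem n j 1 = sd_elem n j 1 \<otimes>\<^bsub>SD8 n\<^esub> sd_elem n i 1
      \<longleftrightarrow> i mod d = j mod d" for i j
    using sd_elem_reflections_commute_iff[OF n] by (simp add: d_def cong_def)
  have "inj_on (\<lambda>i. sd_elem n i 1) {..<d}"
    using d by (auto intro!: inj_onI simp: sd_elem_eq_iff[OF n] cong_def)
  moreover have "sd_elem n 1 0 \<notin> (\<lambda>i. sd_elem n i 1) ` {..<d}"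
    by (auto simp: sd_elem_eq_iff[OF n])
  ultimately have card_I: "card I = d + 1" by (simp add: I_def card_image)
  have "vertex_covering_number (commuting_graph (SD8 n)) = card ?V - card I"
    unfolding commuting_graph_def
  proof (rule vertex_covering_number_eqI[where \<K> = \<K>])
    fix e assume "e \<in> {{x, y} |x y. x \<in> ?V \<and> y \<in> ?V \<and> x \<noteq> y \<and>
        x \<otimes>\<^bsub>SD8 n\<^esub> y = y \<otimes>\<^bsub>SD8 n\<^esub> x}"
    then obtain x y where e: "e = {x, y}" "x \<noteq> y" "x \<otimes>\<^bsub>SD8 n\<^esub> y = y \<otimes>\<^bsub>SD8 n\<^esub> x" by blast
    have "x = y" if "x \<in> I" "y \<in> I"
    proof -
      \<comment> \<open>The mixed cases contradict that \<open>a\<close> commutes with no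
        \<open>a\<^sup>i b\<close>. In the last case \<open>i\<close> and \<open>j\<close> are
        congruent modulo \<open>d\<close> and below \<open>d\<close>, hence equal.\<close>
      consider "x = sd_elem n 1 0" "y = sd_elem n 1 0"
        | i where "x = sd_elem n 1 0" "y = sd_elem n i 1"
        | i where "x = sd_elem n i 1" "y = sd_elem n 1 0"
        | i j where "x = sd_elem n i 1" "y = sd_elem n j 1" "i < d" "j < d"
        using \<open>x \<in> I\<close> \<open>y \<in> I\<close> unfolding I_def by blast
      then show ?thesis
        using e(3) sd_elem_rotation_not_commute[OF assms(1)]
          sd_elem_rotation_not_commute[OF assms(1), THEN not_sym] comm by cases auto
    qed
    with e show "\<not> e \<subseteq> I" by auto
  next
    show "?V \<subseteq> \<Union>\<K>"
    proof
      fix x assume "x \<in> ?V"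
      then obtain i p where x: "x = sd_elem n i p" "p < 2"
        by (auto simp: carrier_SD8[OF n])
      then consider "p = 0" | "p = 1" by linarith
      then show "x \<in> \<Union>\<K>"
      proof cases
        case 1
        with x(1) show ?thesis by (auto simp: \<K>_def)
      next
        case 2
        with x(1) have "x \<in> B (i mod d)" by (auto simp: B_def)
        with d(1) show ?thesis by (auto simp: \<K>_def)
      qed
    qed
    \<comment> \<open>Only an upper bound is wanted, so coincidences among the cliques would be
      harmless.\<close>
    have "card (insert (range (\<lambda>i. sd_elem n i 0)) (B ` {..<d})) \<le> Suc (card (B ` {..<d}))"
      by (rule card_insert_le_m1) auto
    also have "\<dots> \<le> card I" using card_image_le[of "{..<d}" B] by (simp add: card_I)
    finally show "card \<K> \<le> card I" by (simp add: \<K>_def)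
  next
    fix K x y assume K: "K \<in> \<K>" "x \<in> K" "y \<in> K" "x \<noteq> y"
    from K(1) consider "K = range (\<lambda>i. sd_elem n i 0)" | r where "K = B r"
      unfolding \<K>_def by blast
    then have "x \<otimes>\<^bsub>SD8 n\<^esub> y = y \<otimes>\<^bsub>SD8 n\<^esub> x \<and> x \<in> ?V \<and> y \<in> ?V"
    proof cases
      case 1
      with K(2,3) obtain i j where "x = sd_elem n i 0" "y = sd_elem n j 0" by blast
      then show ?thesis by (simp add: sd_elem_rotations_commute[OF n])
    next
      case (2 r)
      with K(2,3) obtain i j
        where "x = sd_elem n i 1" "y = sd_elem n j 1" "i mod d = r" "j mod d = r"
        unfolding B_def by blast
      then show ?thesis using comm[of i j] by simp
    qed
    with K(4) show "{x, y} \<in> {{x, y} |x y. x \<in> ?V \<and> y \<in> ?V \<and> x \<noteq> y \<and>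
        x \<otimes>\<^bsub>SD8 n\<^esub> y = y \<otimes>\<^bsub>SD8 n\<^esub> x}"
      by blast
  qed (use finite_carrier_SD8[OF n] in \<open>auto simp: I_def \<K>_def\<close>)
  then show ?thesis by (simp add: card_carrier_SD8[OF n] card_I)
qed

theorem corollary4p15:
  fixes n :: nat
  assumes "n \<ge> 1"
  shows "vertex_covering_number (commuting_graph (SD8 n)) =
           (if n = 1 then 7 else if even n then 6 * n - 1 else 7 * n - 1) \<and>
         edge_covering_number (commuting_graph (SD8 n)) = 4 * n"
  using assms vertex_covering_number_SD8[of n] edge_covering_number_SD8[of n]
    vertex_covering_number_SD8_1
  by auto

end
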